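(* Let $p,q\ge 0$ be integers and let $a_1,\dots,a_p,b_1,\dots,b_q$ be arbitrary constants. For every integer $N\ge 0$ put $$F_N(x)={}_{p+N+1}F_{q+N+1}\Bigl(a_1,\dots,a_p,\tfrac{\alpha+1}{\gamma},\tfrac{\alpha+\beta+1}{\gamma},\dots,\tfrac{\alpha+N\beta+1}{\gamma};\,b_1,\dots,b_q,\tfrac{\alpha+\gamma+1}{\gamma},\tfrac{\alpha+\gamma+\beta+1}{\gamma},\dots,\tfrac{\alpha+\gamma+N\beta+1}{\gamma};\,\lambda x^{\gamma}\Bigr).$$ Then, for any constants $\alpha,\beta,\eta,\lambda$ and any nonzero constant $\gamma$, $$\int x^\alpha \sinh(\eta x^\beta)\,{}_pF_q(a_1,\dots,a_p;b_1,\dots,b_q;\lambda x^{\gamma})\,dx = x^{\alpha+1}\sinh(\eta x^\beta)\sum_{j=0}^{\infty}\frac{(\beta\eta x^\beta)^{2j}}{\prod_{m=0}^{2j}(\alpha+m\beta+1)}\,F_{2j}(x)-x^{\alpha+1}\cosh(\eta x^\beta)\sum_{j=0}^{\infty}\frac{(\beta\eta x^\beta)^{2j+1}}{\prod_{m=0}^{2j+1}(\alpha+m\beta+1)}\,F_{2j+1}(x)+C,$$ where $C$ is an arbitrary constant of integration.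
   Context: Constants are real or complex. The generalized hypergeometric function is defined by the series $${}_pF_q(a_1,\dots,a_p;b_1,\dots,b_q;x)=\sum_{n=0}^{\infty}\frac{(a_1)_n\cdots(a_p)_n}{(b_1)_n\cdots(b_q)_n}\frac{x^n}{n!},$$ with Pochhammer symbol $(\vartheta)_n=\Gamma(\vartheta+n)/\Gamma(\vartheta)$, $(\vartheta)_0=1$. The integral is an indefinite integral (antiderivative) in $x$.
   Formalization: All denominators must be nonzero, the integrand's series converges on an open connected domain with a branch of log x; if (α+1)/γ is real and β/γ is a negative irrational, the two sums over j are also assumed to converge (they can diverge for Liouville β/γ). *)

theory Defs
  imports "HOL-Complex_Analysis.Complex_Analysis"
begin

text \<open>
  \<^term>\<open>eval_fps (fps_hypergeo a b 1) z\<close> is the series pFq(a; b; z) with \<open>p = length a\<close> and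
  \<open>q = length b\<close>. As \<^const>\<open>eval_fps\<close> has an arbitrary value where the series diverges, convergence
  is expressed separately. If some entry of \<open>b\<close> is a nonpositive integer, the terms with a
  vanishing denominator are \<open>0\<close>.
\<close>

definition hypergeom :: "complex list \<Rightarrow> complex list \<Rightarrow> complex \<Rightarrow> complex" where
  "hypergeom a b z = eval_fps (fps_hypergeo a b 1) z"

definition hypergeom_converges :: "complex list \<Rightarrow> complex list \<Rightarrow> complex \<Rightarrow> bool" where
  "hypergeom_converges a b z \<longleftrightarrow> summable (\<lambda>n. fps_nth (fps_hypergeo a b 1) n * z ^ n)"

text \<open>
  All powers of the variable are taken with respect to one holomorphic branch \<open>L\<close> of the logarithm
  on a domain \<open>S\<close>. For \<open>L = Ln\<close> and \<open>x \<noteq> 0\<close>, \<open>branch_power L x c\<close> is \<open>x powr c\<close>; other branches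
  cover, for instance, the negative real axis.
\<close>

definition log_branch_on :: "complex set \<Rightarrow> (complex \<Rightarrow> complex) \<Rightarrow> bool" where
  "log_branch_on S L \<longleftrightarrow> L holomorphic_on S \<and> (\<forall>x\<in>S. exp (L x) = x)"

definition branch_power :: "(complex \<Rightarrow> complex) \<Rightarrow> complex \<Rightarrow> complex \<Rightarrow> complex" where
  "branch_power L x c = exp (c * L x)"

definition F_upper :: "complex list \<Rightarrow> complex \<Rightarrow> complex \<Rightarrow> complex \<Rightarrow> nat \<Rightarrow> complex list" where
  "F_upper a \<alpha> \<beta> \<gamma> N = a @ map (\<lambda>m. (\<alpha> + of_nat m * \<beta> + 1) / \<gamma>) [0..<N + 1]"

definition F_lower :: "complex list \<Rightarrow> complex \<Rightarrow> complex \<Rightarrow> complex \<Rightarrow> nat \<Rightarrow> complex list" where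
  "F_lower b \<alpha> \<beta> \<gamma> N = b @ map (\<lambda>m. (\<alpha> + \<gamma> + of_nat m * \<beta> + 1) / \<gamma>) [0..<N + 1]"

definition F_term ::
  "(complex \<Rightarrow> complex) \<Rightarrow> complex list \<Rightarrow> complex list \<Rightarrow>
   complex \<Rightarrow> complex \<Rightarrow> complex \<Rightarrow> complex \<Rightarrow> complex \<Rightarrow> nat \<Rightarrow> complex \<Rightarrow> complex" where
  "F_term L a b \<alpha> \<beta> \<gamma> \<eta> l N x =
     (\<beta> * \<eta> * branch_power L x \<beta>) ^ N / (\<Prod>m=0..N. \<alpha> + of_nat m * \<beta> + 1) *
     hypergeom (F_upper a \<alpha> \<beta> \<gamma> N) (F_lower b \<alpha> \<beta> \<gamma> N) (l * branch_power L x \<gamma>)"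

text \<open>
  Expanding the hypergeometric functions produces the denominators \<open>\<alpha> + m * \<beta> + n * \<gamma> + 1\<close>. Assume
  that none of them vanishes. Then they come arbitrarily close to \<open>0\<close> exactly in the following case.
  There, for \<open>\<beta> / \<gamma>\<close> sufficiently well approximable by rationals (Liouville numbers), the series of
  the \<open>F_term\<close> can diverge although every single term is well defined.
\<close>

definition small_divisors :: "complex \<Rightarrow> complex \<Rightarrow> complex \<Rightarrow> bool" where
  "small_divisors \<alpha> \<beta> \<gamma> \<longleftrightarrow>
     (\<alpha> + 1) / \<gamma> \<in> \<real> \<and> \<beta> / \<gamma> \<in> \<real> \<and> \<beta> / \<gamma> \<notin> \<rat> \<and> Re (\<beta> / \<gamma>) < 0"

definition F_series_converge ::
  "(complex \<Rightarrow> complex) \<Rightarrow> complex list \<Rightarrow> complex list \<Rightarrow>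
   complex \<Rightarrow> complex \<Rightarrow> complex \<Rightarrow> complex \<Rightarrow> complex \<Rightarrow> complex \<Rightarrow> bool" where
  "F_series_converge L a b \<alpha> \<beta> \<gamma> \<eta> l x \<longleftrightarrow>
     summable (\<lambda>j. F_term L a b \<alpha> \<beta> \<gamma> \<eta> l (2 * j) x) \<and>
     summable (\<lambda>j. F_term L a b \<alpha> \<beta> \<gamma> \<eta> l (2 * j + 1) x)"

end

theory Submission
  imports Defs
begin

text \<open>
  All powers \<open>x powr c\<close> below are \<open>exp (c * L x)\<close>. Write \<open>U N = x powr (\<alpha> + 1) * F_term N\<close> and
  \<open>v = \<eta> * x powr \<beta>\<close>. The ratio of the two Pochhammer symbols belonging to the
  parameters \<open>s = (\<alpha> + m\<beta> + 1) / \<gamma>\<close> and \<open>s + 1\<close> is \<open>s / (s + n)\<close>, so \<open>F_term N\<close> is,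
  up to the factor \<open>(\<beta> * v) ^ N\<close>, the series pFq with its \<open>n\<close>-th coefficient divided by
  \<open>\<alpha> + m\<beta> + 1 + n\<gamma>\<close> for every \<open>m \<le> N\<close> (\<open>fps_nth_hypergeo_F\<close>). Each such division is one integration: the
  monomial \<open>x powr (\<alpha> + m\<beta> + n\<gamma>)\<close> is the derivative of \<open>x powr (\<alpha> + m\<beta> + 1 + n\<gamma>)\<close> over that divisor. Hence
  \<open>U 0\<close> is an antiderivative of \<open>x powr \<alpha> * pFq\<close> and \<open>U (N + 1)\<close> one of \<open>v' * U N\<close>
  (\<open>damped_has_derivative\<close>). The claimed formula is what infinitely many integrations by parts produce.

  Stopping after finitely many of them leaves the error \<open>sinh v * v' * U (2 * J + 1)\<close> in the derivative.
  It tends to \<open>0\<close> locally uniformly as soon as the two series converge: near \<open>x0\<close>, the sup norm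
  of \<open>U (N + 1)\<close> is at most half that of \<open>U N\<close> plus the modulus of the value at \<open>x0\<close>,
  which tends to \<open>0\<close> (\<open>iterated_antiderivatives_uniform_limit\<close>). Pointwise convergence is therefore
  enough for termwise differentiation (\<open>sinh_parts_series_has_derivative\<close>), also in the case of small
  divisors, where convergence is assumed and no estimate of the terms is at hand.

  Without small divisors the divisors stay away from \<open>0\<close> (\<open>divisors_bounded_below\<close>). For fixed \<open>n\<close> and \<open>\<beta> \<noteq> 0\<close> they
  form an arithmetic progression in \<open>m\<close>, of which a number bounded independently of \<open>n\<close> lie in a given
  disc. Their products hence grow faster than any geometric sequence, uniformly in \<open>n\<close>
  (\<open>prod_affine_norm_lower_bound\<close>), and the two series converge absolutely.

  Everything takes place strictly inside the disc of convergence in \<open>x powr \<gamma>\<close>, because \<open>x powr \<gamma>\<close> has an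
  open image and so attains a larger modulus at another point of the domain
  (\<open>branch_power_inside_convergence_disc\<close>). The constant \<open>l\<close> is absorbed into the coefficients, which
  makes \<open>l = 0\<close> an ordinary case even if pFq has radius of convergence \<open>0\<close>.
\<close>

section \<open>Differentiating a series of iterated antiderivatives\<close>

lemma halving_recurrence_tendsto_0:
  fixes a B :: "nat \<Rightarrow> real"
  assumes a: "a \<longlonglongrightarrow> 0" and a0: "\<And>n. 0 \<le> a n"
    and B0: "\<And>n. 0 \<le> B n" and rec: "\<And>n. B (Suc n) \<le> a n + B n / 2"
  shows "B \<longlonglongrightarrow> 0"
proof (rule LIMSEQ_I)
  fix e :: real assume e: "0 < e"
  obtain M where M: "\<And>n. n \<ge> M \<Longrightarrow> a n < e / 4"
    using LIMSEQ_D[OF a, of "e / 4"] e a0 by auto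
  have decay: "B (M + k) \<le> e / 2 + B M * (1 / 2) ^ k" for k
  proof (induction k)
    case (Suc k)
    show ?case using rec[of "M + k"] M[of "M + k"] Suc by simp
  qed (use e in simp)
  have "(\<lambda>k. B M * (1 / 2) ^ k) \<longlonglongrightarrow> B M * 0"
    by (intro tendsto_intros) auto
  then obtain K where K: "\<And>k. k \<ge> K \<Longrightarrow> B M * (1 / 2) ^ k < e / 2"
    using LIMSEQ_D[of "\<lambda>k. B M * (1 / 2) ^ k" 0 "e / 2"] e B0 by auto
  show "\<exists>no. \<forall>n\<ge>no. norm (B n - 0) < e"
  proof (intro exI allI impI)
    fix n assume n: "n \<ge> M + K"
    then have le: "K \<le> n - M" by simp
    have "B n \<le> e / 2 + B M * (1 / 2) ^ (n - M)" using decay[of "n - M"] n by simp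
    also have "\<dots> < e" using K[OF le] by linarith
    finally show "norm (B n - 0) < e" using B0[of n] by simp
  qed
qed

lemma even_odd_tendsto:
  fixes f :: "nat \<Rightarrow> 'a :: topological_space"
  assumes "(\<lambda>n. f (2 * n)) \<longlonglongrightarrow> l" "(\<lambda>n. f (2 * n + 1)) \<longlonglongrightarrow> l"
  shows "f \<longlonglongrightarrow> l"
proof (rule topological_tendstoI)
  fix T assume "open T" "l \<in> T"
  then have "\<forall>\<^sub>F n in sequentially. f (2 * n) \<in> T" "\<forall>\<^sub>F n in sequentially. f (2 * n + 1) \<in> T"
    using assms[THEN topological_tendstoD] by auto
  then obtain M N where MN: "\<And>n. n \<ge> M \<Longrightarrow> f (2 * n) \<in> T" "\<And>n. n \<ge> N \<Longrightarrow> f (2 * n + 1) \<in> T"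
    unfolding eventually_sequentially by blast
  have "f n \<in> T" if "n \<ge> 2 * (M + N) + 1" for n
    by (cases rule: parity_cases[of n]) (use that MN in \<open>auto elim!: evenE oddE\<close>)
  then show "\<forall>\<^sub>F n in sequentially. f n \<in> T"
    unfolding eventually_sequentially by blast
qed

text \<open>
  On a disc around \<open>x0\<close> so small that its radius times a bound of \<open>v'\<close> is at most \<open>1 / 2\<close>, the mean value
  inequality bounds \<open>U (n + 1)\<close> by its value at \<open>x0\<close> plus half the bound of \<open>U n\<close>. The radius does not depend
  on \<open>n\<close>, so a null sequence at the single point \<open>x0\<close> is a uniform null sequence on the disc.
\<close>

lemma iterated_antiderivatives_uniform_limit:
  fixes U :: "nat \<Rightarrow> complex \<Rightarrow> complex" and v' h :: "complex \<Rightarrow> complex"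
  assumes S: "open S" "x0 \<in> S" and v': "continuous_on S v'"
    and U0: "\<And>x. x \<in> S \<Longrightarrow> (U 0 has_field_derivative h x) (at x)"
    and U: "\<And>n x. x \<in> S \<Longrightarrow> (U (Suc n) has_field_derivative v' x * U n x) (at x)"
    and null: "(\<lambda>n. U n x0) \<longlonglongrightarrow> 0"
  obtains r where "r > 0" "cball x0 r \<subseteq> S" "uniform_limit (cball x0 r) U (\<lambda>_. 0) sequentially"
proof -
  obtain R where R: "R > 0" "cball x0 R \<subseteq> S" using S open_contains_cball by blast
  obtain K where K: "K \<ge> 0" "\<And>x. x \<in> cball x0 R \<Longrightarrow> norm (v' x) \<le> K"
    using continuous_on_compact_bound[OF compact_cball continuous_on_subset[OF v' R(2)]] by blast
  define r where "r = min R (1 / (2 * (K + 1)))"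
  have r: "r > 0" "r \<le> R" "K * r \<le> 1 / 2"
  proof -
    have "K * r \<le> K * (1 / (2 * (K + 1)))" using K by (intro mult_left_mono) (auto simp: r_def)
    also have "\<dots> \<le> 1 / 2" using K by (simp add: field_simps)
    finally show "K * r \<le> 1 / 2" .
  qed (use R K in \<open>auto simp: r_def\<close>)
  have sub: "cball x0 r \<subseteq> cball x0 R" using r by auto
  have "continuous_on S (U 0)" using U0
    by (meson DERIV_isCont continuous_at_imp_continuous_on)
  then have "continuous_on (cball x0 r) (U 0)" using R sub continuous_on_subset by blast
  then obtain B0 where B0: "B0 \<ge> 0" "\<And>x. x \<in> cball x0 r \<Longrightarrow> norm (U 0 x) \<le> B0"
    using continuous_on_compact_bound[OF compact_cball] by blast
  define B where "B = rec_nat B0 (\<lambda>n b. norm (U (Suc n) x0) + b / 2)"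
  have B_0: "B 0 = B0" and B_Suc: "B (Suc n) = norm (U (Suc n) x0) + B n / 2" for n
    by (simp_all add: B_def)
  have B_nonneg: "0 \<le> B n" for n
    by (induction n) (use B0 in \<open>auto simp: B_0 B_Suc\<close>)
  have bound: "norm (U n x) \<le> B n" if "x \<in> cball x0 r" for n x
    using that
  proof (induction n arbitrary: x)
    case (Suc n)
    have "norm (U (Suc n) x - U (Suc n) x0) \<le> (K * B n) * norm (x - x0)"
    proof (rule field_differentiable_bound[where S = "cball x0 r" and f' = "\<lambda>x. v' x * U n x"])
      fix z assume z: "z \<in> cball x0 r"
      show "(U (Suc n) has_field_derivative v' z * U n z) (at z within cball x0 r)"
        using z sub R(2) by (intro has_field_derivative_at_within[OF U]) auto
      show "norm (v' z * U n z) \<le> K * B n"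
        unfolding norm_mult using z sub K(1) by (intro mult_mono K(2) Suc.IH[OF z]) auto
    qed (use r Suc.prems in auto)
    also have "\<dots> \<le> (K * B n) * r"
      using Suc.prems K B_nonneg by (intro mult_left_mono) (auto simp: dist_norm norm_minus_commute)
    also have "\<dots> = (K * r) * B n" by simp
    also have "\<dots> \<le> 1 / 2 * B n" using r B_nonneg by (intro mult_right_mono) auto
    finally show ?case using norm_triangle_sub[of "U (Suc n) x" "U (Suc n) x0"] by (simp add: B_Suc)
  qed (use B0 in \<open>auto simp: B_0\<close>)
  have "B \<longlonglongrightarrow> 0"
  proof (rule halving_recurrence_tendsto_0)
    show "(\<lambda>n. norm (U (Suc n) x0)) \<longlonglongrightarrow> 0"
      using LIMSEQ_Suc[OF null] by (rule tendsto_norm_zero)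
  qed (auto simp: B_nonneg B_Suc)
  have "uniform_limit (cball x0 r) U (\<lambda>_. 0) sequentially"
  proof (rule uniform_limitI)
    fix e :: real assume "e > 0"
    have "\<forall>\<^sub>F n in sequentially. B n < e"
      using \<open>B \<longlonglongrightarrow> 0\<close> \<open>e > 0\<close> by (rule order_tendstoD)
    then show "\<forall>\<^sub>F n in sequentially. \<forall>x\<in>cball x0 r. dist (U n x) 0 < e"
      by eventually_elim (auto intro: le_less_trans[OF bound])
  qed
  then show thesis using that r R sub by blast
qed

text \<open>
  With \<open>P\<close> and \<open>Q\<close> the partial sums of the even and odd series, \<open>Q' = v' * P\<close> and
  \<open>P' = h + v' * (Q - U (2 * J + 1))\<close>. In the derivative of \<open>sinh v * P - cosh v * Q\<close> everything cancels except
  \<open>sinh v * h\<close> and the last odd term, which vanishes locally uniformly in the limit.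
\<close>

lemma sinh_parts_series_has_derivative:
  fixes U :: "nat \<Rightarrow> complex \<Rightarrow> complex" and v v' h :: "complex \<Rightarrow> complex"
  assumes S: "open S" "x0 \<in> S"
    and v: "\<And>x. x \<in> S \<Longrightarrow> (v has_field_derivative v' x) (at x)" and v': "continuous_on S v'"
    and U0: "\<And>x. x \<in> S \<Longrightarrow> (U 0 has_field_derivative h x) (at x)"
    and U: "\<And>n x. x \<in> S \<Longrightarrow> (U (Suc n) has_field_derivative v' x * U n x) (at x)"
    and even: "\<And>x. x \<in> S \<Longrightarrow> summable (\<lambda>j. U (2 * j) x)"
    and odd: "\<And>x. x \<in> S \<Longrightarrow> summable (\<lambda>j. U (2 * j + 1) x)"
  shows "((\<lambda>x. sinh (v x) * (\<Sum>j. U (2 * j) x) - cosh (v x) * (\<Sum>j. U (2 * j + 1) x))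
           has_field_derivative sinh (v x0) * h x0) (at x0)"
proof -
  define W where "W = (\<lambda>x. sinh (v x) * (\<Sum>j. U (2 * j) x) - cosh (v x) * (\<Sum>j. U (2 * j + 1) x))"
  define P where "P = (\<lambda>J x. \<Sum>j<Suc J. U (2 * j) x)"
  define Q where "Q = (\<lambda>J x. \<Sum>j<Suc J. U (2 * j + 1) x)"
  have null: "(\<lambda>n. U n x0) \<longlonglongrightarrow> 0"
    by (rule even_odd_tendsto[where f = "\<lambda>n. U n x0"])
      (rule summable_LIMSEQ_zero[OF even[OF S(2)]], rule summable_LIMSEQ_zero[OF odd[OF S(2)]])
  obtain r where r: "r > 0" "cball x0 r \<subseteq> S"
    and unif: "uniform_limit (cball x0 r) U (\<lambda>_. 0) sequentially"
    by (rule iterated_antiderivatives_uniform_limit[OF S v' U0 U null])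
  have Q': "(Q J has_field_derivative v' x * P J x) (at x)" if "x \<in> S" for J x
    unfolding P_def Q_def sum_distrib_left
    by (intro DERIV_sum) (use U[OF that] in auto)
  have P': "(P J has_field_derivative h x + v' x * (Q J x - U (2 * J + 1) x)) (at x)"
    if x: "x \<in> S" for J x
  proof (induction J)
    case 0
    show ?case using U0[OF x] by (simp add: P_def Q_def)
  next
    case (Suc J)
    have "((\<lambda>x. P J x + U (2 * Suc J) x) has_field_derivative
        h x + v' x * (Q J x - U (2 * J + 1) x) + v' x * U (2 * J + 1) x) (at x)"
      using U[OF x, of "2 * J + 1"] by (intro DERIV_add Suc) simp
    then show ?case by (simp add: P_def Q_def algebra_simps)
  qed
  have sinh': "((\<lambda>x. sinh (v x)) has_field_derivative cosh (v x) * v' x) (at x)"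
    and cosh': "((\<lambda>x. cosh (v x)) has_field_derivative sinh (v x) * v' x) (at x)"
    if "x \<in> S" for x
    using v[OF that] by (auto intro!: derivative_eq_intros)
  have W': "((\<lambda>x. sinh (v x) * P J x - cosh (v x) * Q J x) has_field_derivative
      sinh (v x) * h x - sinh (v x) * v' x * U (2 * J + 1) x) (at x)" if x: "x \<in> S" for J x
    using DERIV_diff[OF DERIV_mult[OF sinh' P'] DERIV_mult[OF cosh' Q'], OF x x x x]
    by (rule DERIV_cong) (simp add: algebra_simps)
  have contS: "continuous_on S (\<lambda>x. sinh (v x) * v' x)"
    using v v' by (intro continuous_intros) (meson DERIV_isCont continuous_at_imp_continuous_on)
  have lim: "(\<lambda>J. sinh (v x) * P J x - cosh (v x) * Q J x) \<longlonglongrightarrow> W x" if x: "x \<in> S" for x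
    unfolding W_def P_def Q_def
    by (intro tendsto_intros LIMSEQ_Suc summable_LIMSEQ even odd x)
  obtain K where K: "K \<ge> 0" "\<And>x. x \<in> cball x0 r \<Longrightarrow> norm (sinh (v x) * v' x) \<le> K"
    using continuous_on_compact_bound[OF compact_cball continuous_on_subset[OF contS r(2)]] by blast
  have "\<exists>g. \<forall>x\<in>cball x0 r. (\<lambda>J. sinh (v x) * P J x - cosh (v x) * Q J x) \<longlonglongrightarrow> g x \<and>
      (g has_field_derivative sinh (v x) * h x) (at x within cball x0 r)"
  proof (rule has_complex_derivative_sequence)
    show "((\<lambda>x. sinh (v x) * P J x - cosh (v x) * Q J x) has_field_derivative
      sinh (v x) * h x - sinh (v x) * v' x * U (2 * J + 1) x) (at x within cball x0 r)"
      if "x \<in> cball x0 r" for J x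
      using that r(2) by (intro has_field_derivative_at_within[OF W']) auto
    fix e :: real assume e: "e > 0"
    then have "\<forall>\<^sub>F n in sequentially. \<forall>x\<in>cball x0 r. dist (U n x) 0 < e / (K + 1)"
      using K unif by (intro uniform_limitD) auto
    then obtain N where N: "\<And>n x. n \<ge> N \<Longrightarrow> x \<in> cball x0 r \<Longrightarrow> norm (U n x) < e / (K + 1)"
      unfolding eventually_sequentially dist_norm diff_zero by blast
    show "\<exists>N. \<forall>J x. N \<le> J \<longrightarrow> x \<in> cball x0 r \<longrightarrow>
        norm (sinh (v x) * h x - sinh (v x) * v' x * U (2 * J + 1) x - sinh (v x) * h x) \<le> e"
    proof (intro exI allI impI)
      fix J x assume J: "N \<le> J" and x: "x \<in> cball x0 r"
      have "norm (sinh (v x) * v' x * U (2 * J + 1) x) \<le> K * (e / (K + 1))"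
        unfolding norm_mult[of "sinh (v x) * v' x"]
        using K N[of "2 * J + 1" x] J x by (intro mult_mono) auto
      also have "\<dots> \<le> e" using K e by (simp add: field_simps)
      finally show "norm (sinh (v x) * h x - sinh (v x) * v' x * U (2 * J + 1) x - sinh (v x) * h x) \<le> e"
        by simp
    qed
  next
    show "\<exists>x l. x \<in> cball x0 r \<and> (\<lambda>J. sinh (v x) * P J x - cosh (v x) * Q J x) \<longlonglongrightarrow> l"
      using lim[OF S(2)] r(1) by (intro exI[of _ x0] exI[of _ "W x0"]) simp
  qed simp
  then obtain g where g: "\<And>x. x \<in> cball x0 r \<Longrightarrow> (\<lambda>J. sinh (v x) * P J x - cosh (v x) * Q J x) \<longlonglongrightarrow> g x"
    "\<And>x. x \<in> cball x0 r \<Longrightarrow> (g has_field_derivative sinh (v x) * h x) (at x within cball x0 r)"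
    by blast
  have "g x = W x" if "x \<in> cball x0 r" for x
    using LIMSEQ_unique[OF g(1)[OF that] lim] that r by blast
  moreover have "(g has_field_derivative sinh (v x0) * h x0) (at x0)"
    using g(2)[of x0] r at_within_interior[of x0 "cball x0 r"] by simp
  ultimately have "(W has_field_derivative sinh (v x0) * h x0) (at x0)"
    using r by (subst DERIV_cong_ev[OF refl _ refl, of _ g])
      (auto simp: eventually_nhds_metric dist_commute intro!: exI[of _ r])
  then show ?thesis by (simp only: W_def)
qed

section \<open>Lower bounds for the divisors and their products\<close>

lemma nonzero_family_bounded_below:
  fixes f :: "'i \<Rightarrow> complex"
  assumes fin: "finite (range f \<inter> ball 0 1)" and nz: "\<And>i. f i \<noteq> 0"
  obtains \<delta> where "\<delta> > 0" "\<And>i. \<delta> \<le> norm (f i)"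
proof
  define V where "V = insert 1 (norm ` (range f \<inter> ball 0 1))"
  have V: "finite V" "V \<noteq> {}" using fin by (auto simp: V_def)
  show "Min V > 0" using V nz by (auto simp: V_def)
  show "Min V \<le> norm (f i)" for i
  proof (cases "norm (f i) < 1")
    case True
    then show ?thesis using V by (intro Min_le) (auto simp: V_def)
  next
    case False
    have "Min V \<le> 1" using V by (intro Min_le) (auto simp: V_def)
    with False show ?thesis by simp
  qed
qed

text \<open>
  After division by \<open>\<gamma>\<close> the divisors are \<open>s + m\<rho> + n\<close>. If \<open>\<rho>\<close> is not real, or \<open>\<rho> > 0\<close> and \<open>s\<close> is real, only
  finitely many of them lie in the unit disc. For rational \<open>\<rho> = p / q\<close> their values lie in the discrete set
  \<open>s + \<int> / q\<close>. For real \<open>\<rho>\<close> and nonreal \<open>s\<close> their imaginary part is the constant \<open>Im s\<close>. What remains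
  is the case of small divisors.
\<close>

lemma divisors_bounded_below:
  assumes \<gamma>: "\<gamma> \<noteq> 0"
    and nz: "\<And>m n. \<alpha> + of_nat m * \<beta> + 1 + of_nat n * \<gamma> \<noteq> 0"
    and not_small: "\<not> small_divisors \<alpha> \<beta> \<gamma>"
  obtains \<delta> where "\<delta> > 0" "\<And>m n. \<delta> \<le> norm (\<alpha> + of_nat m * \<beta> + 1 + of_nat n * \<gamma>)"
proof -
  define s \<rho> where "s = (\<alpha> + 1) / \<gamma>" and "\<rho> = \<beta> / \<gamma>"
  define f where "f = (\<lambda>(m :: nat, n :: nat). s + of_nat m * \<rho> + of_nat n)"
  have f: "\<alpha> + of_nat m * \<beta> + 1 + of_nat n * \<gamma> = \<gamma> * f (m, n)" for m n
    using \<gamma> by (simp add: f_def s_def \<rho>_def field_simps)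
  have f_nz: "f i \<noteq> 0" for i
    using nz[of "fst i" "snd i"] unfolding f by auto
  have finite_if_m_bounded: "finite (range f \<inter> ball 0 1)"
    if M: "\<And>m n. norm (f (m, n)) < 1 \<Longrightarrow> real m \<le> M" for M
  proof -
    define K where "K = 1 + norm s + M * norm \<rho>"
    have "range f \<inter> ball 0 1 \<subseteq> f ` ({..nat \<lceil>M\<rceil>} \<times> {..nat \<lceil>K\<rceil>})"
    proof
      fix z assume "z \<in> range f \<inter> ball 0 1"
      then obtain m n where z: "z = f (m, n)" "norm (f (m, n)) < 1" by auto
      have m: "real m \<le> M" using M z by blast
      have "real n = norm (f (m, n) - (s + of_nat m * \<rho>))" by (simp add: f_def)
      also have "\<dots> \<le> norm (f (m, n)) + (norm s + norm (of_nat m * \<rho>))"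
        by (rule order_trans[OF norm_triangle_ineq4 add_left_mono[OF norm_triangle_ineq]])
      also have "\<dots> \<le> K"
        using z m by (auto simp: K_def norm_mult intro!: add_mono mult_right_mono)
      finally have "m \<le> nat \<lceil>M\<rceil>" "n \<le> nat \<lceil>K\<rceil>" using m by linarith+
      then show "z \<in> f ` ({..nat \<lceil>M\<rceil>} \<times> {..nat \<lceil>K\<rceil>})" using z by auto
    qed
    then show ?thesis by (rule finite_subset) auto
  qed
  obtain \<delta> where \<delta>: "\<delta> > 0" "\<And>i. \<delta> \<le> norm (f i)"
  proof -
    consider "Im \<rho> \<noteq> 0" | "Im \<rho> = 0" "Im s \<noteq> 0" | "\<rho> \<in> \<rat>"
      | "Im \<rho> = 0" "Im s = 0" "\<rho> \<notin> \<rat>" by blast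
    then show thesis
    proof cases
      case 1
      have "real m \<le> (1 + \<bar>Im s\<bar>) / \<bar>Im \<rho>\<bar>" if "norm (f (m, n)) < 1" for m n
      proof -
        have "\<bar>Im s + real m * Im \<rho>\<bar> < 1"
          using that abs_Im_le_cmod[of "f (m, n)"] by (simp add: f_def)
        then have "\<bar>real m * Im \<rho>\<bar> \<le> 1 + \<bar>Im s\<bar>" by linarith
        then show ?thesis using 1 by (simp add: abs_mult field_simps)
      qed
      then have "finite (range f \<inter> ball 0 1)" by (rule finite_if_m_bounded)
      then show thesis by (rule nonzero_family_bounded_below[OF _ f_nz]) (rule that)
    next
      case 2
      then show thesis
        using abs_Im_le_cmod[of "f _"] by (intro that[of "\<bar>Im s\<bar>"]) (auto simp: f_def)
    next
      case 3
      then obtain p q where q: "q > 0" "\<rho> = of_int p / of_int q" by (rule Rats_cases')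
      define K where "K = \<lceil>real_of_int q * (1 + norm s)\<rceil>"
      have "range f \<inter> ball 0 1 \<subseteq> (\<lambda>k. s + of_int k / of_int q) ` {-K..K}"
      proof
        fix z assume "z \<in> range f \<inter> ball 0 1"
        then obtain m n where z: "z = f (m, n)" "norm z < 1" by auto
        define k where "k = int m * p + int n * q"
        have zk: "z = s + of_int k / of_int q"
          using q by (simp add: z f_def k_def field_simps)
        have "\<bar>real_of_int k\<bar> / real_of_int q = norm (of_int k / of_int q :: complex)"
          using q by (simp add: norm_divide)
        also have "\<dots> = norm (z - s)" by (simp add: zk)
        also have "\<dots> \<le> 1 + norm s" using z norm_triangle_ineq4[of z s] by linarith
        finally have "\<bar>real_of_int k\<bar> \<le> real_of_int q * (1 + norm s)"
          using q by (simp add: field_simps)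
        then have "k \<in> {-K..K}" unfolding K_def by (simp, linarith)
        then show "z \<in> (\<lambda>k. s + of_int k / of_int q) ` {-K..K}" using zk by blast
      qed
      then have "finite (range f \<inter> ball 0 1)" by (rule finite_subset) auto
      then show thesis by (rule nonzero_family_bounded_below[OF _ f_nz]) (rule that)
    next
      case 4
      have "s \<in> \<real>" "\<rho> \<in> \<real>" using 4 by (auto simp: complex_is_Real_iff)
      moreover have "Re \<rho> \<noteq> 0" using 4 complex_eq_iff[of \<rho> 0] by auto
      ultimately have pos: "Re \<rho> > 0"
        using not_small 4 by (auto simp: small_divisors_def s_def \<rho>_def)
      have "real m \<le> (1 + \<bar>Re s\<bar>) / Re \<rho>" if "norm (f (m, n)) < 1" for m n
      proof -
        have "Re s + real m * Re \<rho> + real n < 1"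
          using that complex_Re_le_cmod[of "f (m, n)"] by (simp add: f_def)
        then have "real m * Re \<rho> \<le> 1 + \<bar>Re s\<bar>" by linarith
        then show ?thesis using pos by (simp add: field_simps)
      qed
      then have "finite (range f \<inter> ball 0 1)" by (rule finite_if_m_bounded)
      then show thesis by (rule nonzero_family_bounded_below[OF _ f_nz]) (rule that)
    qed
  qed
  show thesis
  proof (rule that)
    show "norm \<gamma> * \<delta> > 0" using \<gamma> \<delta> by simp
    show "norm \<gamma> * \<delta> \<le> norm (\<alpha> + of_nat m * \<beta> + 1 + of_nat n * \<gamma>)" for m n
      unfolding f norm_mult by (intro mult_left_mono \<delta>) auto
  qed
qed

text \<open>
  Two factors of norm less than \<open>R\<close> have indices that differ by at most \<open>2 * R / norm \<beta>\<close>. The number of these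
  factors is therefore bounded independently of \<open>A\<close> and \<open>k\<close>; each of them costs \<open>\<delta> / R\<close> against the bound \<open>R\<close>
  of the others. Since \<open>R\<close> is arbitrary, the products outgrow every geometric sequence.
\<close>

lemma prod_affine_norm_lower_bound:
  fixes \<beta> :: complex
  assumes \<beta>: "\<beta> \<noteq> 0" and \<delta>: "0 < \<delta>" "\<delta> \<le> R"
  obtains p where "\<And>A k. (\<And>m. \<delta> \<le> norm (A + of_nat m * \<beta>)) \<Longrightarrow>
    (\<delta> / R) ^ p * R ^ k \<le> (\<Prod>m<k. norm (A + of_nat m * \<beta>))"
proof -
  obtain q :: nat where q: "2 * R / norm \<beta> \<le> real q" using real_arch_simple by blast
  have "(\<delta> / R) ^ Suc q * R ^ k \<le> (\<Prod>m<k. norm (A + of_nat m * \<beta>))"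
    if A: "\<And>m. \<delta> \<le> norm (A + of_nat m * \<beta>)" for A k
  proof -
    define near where "near = {m\<in>{..<k}. norm (A + of_nat m * \<beta>) < R}"
    have gap: "j \<le> i + q" if "i \<in> near" "j \<in> near" "i \<le> j" for i j
    proof -
      have "real (j - i) * norm \<beta> = norm ((A + of_nat j * \<beta>) - (A + of_nat i * \<beta>))"
        using that(3) by (simp add: norm_mult of_nat_diff flip: left_diff_distrib)
          (metis norm_of_nat of_nat_diff)
      also have "\<dots> \<le> R + R"
        using that(1,2) norm_triangle_ineq4[of "A + of_nat j * \<beta>" "A + of_nat i * \<beta>"]
        by (simp add: near_def)
      finally have "real (j - i) \<le> 2 * R / norm \<beta>" using \<beta> by (simp add: field_simps)
      with q show ?thesis by linarith
    qed
    have "card near \<le> Suc q"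
    proof (cases "near = {}")
      case False
      have "finite near" by (simp add: near_def)
      then have "near \<subseteq> {Min near..Min near + q}"
        using False gap[OF Min_in] by (auto intro: Min_le)
      then have "card near \<le> card {Min near..Min near + q}" by (intro card_mono) auto
      then show ?thesis by simp
    qed simp
    then have "(\<delta> / R) ^ Suc q * R ^ k \<le> (\<delta> / R) ^ card near * R ^ k"
      using \<delta> by (intro mult_right_mono power_decreasing) auto
    also have "\<dots> = (\<Prod>m<k. (if m \<in> near then \<delta> / R else 1) * R)"
      using card_eq_sum by (simp add: prod.distrib prod.If_cases near_def Int_def)
    also have "\<dots> \<le> (\<Prod>m<k. norm (A + of_nat m * \<beta>))"
      using \<delta> A by (intro prod_mono) (auto simp: near_def)
    finally show ?thesis .
  qed
  then show thesis using that by blast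
qed

section \<open>Power series damped by the divisors\<close>

text \<open>
  The \<open>k\<close>-fold antiderivative underlying the formula: \<open>F_term\<close> of index \<open>N\<close> corresponds to \<open>k = N + 1\<close>, and the
  original series to \<open>k = 0\<close>.
\<close>

definition damped :: "complex fps \<Rightarrow> complex \<Rightarrow> complex \<Rightarrow> complex \<Rightarrow> nat \<Rightarrow> complex fps" where
  "damped c \<alpha> \<beta> \<gamma> k =
     Abs_fps (\<lambda>n. fps_nth c n / (\<Prod>m<k. \<alpha> + of_nat m * \<beta> + 1 + of_nat n * \<gamma>))"

lemma damped_0 [simp]: "damped c \<alpha> \<beta> \<gamma> 0 = c"
  by (simp add: damped_def fps_eq_iff)

lemma fps_nth_damped_Suc:
  assumes "\<alpha> + of_nat k * \<beta> + 1 + of_nat n * \<gamma> \<noteq> 0"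
  shows "(\<alpha> + of_nat k * \<beta> + 1 + of_nat n * \<gamma>) * fps_nth (damped c \<alpha> \<beta> \<gamma> (Suc k)) n =
    fps_nth (damped c \<alpha> \<beta> \<gamma> k) n"
  using assms by (simp add: damped_def)

text \<open>
  For fixed \<open>k\<close> all divisors have norm at least \<open>1\<close> once \<open>n\<close> is large, because \<open>n * \<gamma>\<close> tends to infinity.
\<close>

lemma fps_conv_radius_damped_ge:
  assumes \<gamma>: "\<gamma> \<noteq> 0"
  shows "fps_conv_radius c \<le> fps_conv_radius (damped c \<alpha> \<beta> \<gamma> k)"
  unfolding fps_conv_radius_def
proof (rule conv_radius_geI_ex')
  fix r assume r: "0 < r" "ereal r < conv_radius (fps_nth c)"
  have "\<forall>\<^sub>F n in sequentially. 1 \<le> norm (\<alpha> + of_nat m * \<beta> + 1 + of_nat n * \<gamma>)" for m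
  proof -
    have "\<forall>\<^sub>F n in sequentially. (1 + norm (\<alpha> + of_nat m * \<beta> + 1)) / norm \<gamma> \<le> real n"
      by (rule eventually_sequentiallyI[of "nat \<lceil>(1 + norm (\<alpha> + of_nat m * \<beta> + 1)) / norm \<gamma>\<rceil>"]) linarith
    then show ?thesis
    proof eventually_elim
      case (elim n)
      then have "1 + norm (\<alpha> + of_nat m * \<beta> + 1) \<le> norm (of_nat n * \<gamma>)"
        using \<gamma> by (simp add: field_simps norm_mult)
      then show ?case
        using norm_diff_ineq[of "of_nat n * \<gamma>" "\<alpha> + of_nat m * \<beta> + 1"] by (simp add: add.commute)
    qed
  qed
  then have "\<forall>\<^sub>F n in sequentially. \<forall>m\<in>{..<k}. 1 \<le> norm (\<alpha> + of_nat m * \<beta> + 1 + of_nat n * \<gamma>)"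
    by (intro eventually_ball_finite) auto
  then have "\<forall>\<^sub>F n in sequentially. norm (fps_nth (damped c \<alpha> \<beta> \<gamma> k) n * of_real r ^ n) \<le>
      norm (fps_nth c n * of_real r ^ n)"
  proof eventually_elim
    case (elim n)
    then have "1 \<le> (\<Prod>m<k. norm (\<alpha> + of_nat m * \<beta> + 1 + of_nat n * \<gamma>))"
      by (intro prod_ge_1) auto
    then have "norm (fps_nth c n) / norm (\<Prod>m<k. \<alpha> + of_nat m * \<beta> + 1 + of_nat n * \<gamma>) \<le> norm (fps_nth c n) / 1"
      by (intro divide_left_mono) (auto simp flip: prod_norm)
    then have "norm (fps_nth (damped c \<alpha> \<beta> \<gamma> k) n) \<le> norm (fps_nth c n)"
      by (simp add: damped_def norm_divide)
    then show ?case
      unfolding norm_mult by (intro mult_right_mono) auto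
  qed
  moreover have "summable (\<lambda>n. norm (fps_nth c n * of_real r ^ n))"
    using r by (intro abs_summable_in_conv_radius) simp
  ultimately show "summable (\<lambda>n. fps_nth (damped c \<alpha> \<beta> \<gamma> k) n * of_real r ^ n)"
    by (rule summable_comparison_test_ev)
qed

text \<open>
  The Euler operator \<open>y * d/dy\<close> multiplies the \<open>n\<close>-th coefficient by \<open>n\<close>, so \<open>\<alpha> + k\<beta> + 1 + \<gamma> * y * d/dy\<close>
  undoes the division by the divisors of index \<open>k\<close>.
\<close>

lemma eval_fps_damped_Suc:
  assumes \<gamma>: "\<gamma> \<noteq> 0" and nz: "\<And>n. \<alpha> + of_nat k * \<beta> + 1 + of_nat n * \<gamma> \<noteq> 0"
    and y: "ereal (norm y) < fps_conv_radius c"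
  shows "(\<alpha> + of_nat k * \<beta> + 1) * eval_fps (damped c \<alpha> \<beta> \<gamma> (Suc k)) y +
      \<gamma> * y * eval_fps (fps_deriv (damped c \<alpha> \<beta> \<gamma> (Suc k))) y = eval_fps (damped c \<alpha> \<beta> \<gamma> k) y"
proof -
  define G where "G = damped c \<alpha> \<beta> \<gamma> (Suc k)"
  have yR: "ereal (norm y) < fps_conv_radius (damped c \<alpha> \<beta> \<gamma> j)" for j
    using fps_conv_radius_damped_ge[OF \<gamma>] y by (rule less_le_trans[rotated])
  have yG: "ereal (norm y) < fps_conv_radius G" using yR by (simp add: G_def)
  have "(\<lambda>n. y * (fps_nth (fps_deriv G) n * y ^ n)) sums (y * eval_fps (fps_deriv G) y)"
    using yG fps_conv_radius_deriv[of G] by (intro sums_mult sums_eval_fps) (auto intro: less_le_trans)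
  then have "(\<lambda>n. (of_nat (Suc n) * fps_nth G (Suc n)) * y ^ Suc n) sums (y * eval_fps (fps_deriv G) y)"
    by (simp add: mult_ac)
  then have "(\<lambda>n. (of_nat n * fps_nth G n) * y ^ n) sums (y * eval_fps (fps_deriv G) y)"
    by (subst (asm) sums_Suc_iff) simp
  from sums_add[OF sums_mult[OF sums_eval_fps[OF yG], of "\<alpha> + of_nat k * \<beta> + 1"] sums_mult[OF this, of \<gamma>]]
  have "(\<lambda>n. (\<alpha> + of_nat k * \<beta> + 1 + of_nat n * \<gamma>) * fps_nth G n * y ^ n) sums
      ((\<alpha> + of_nat k * \<beta> + 1) * eval_fps G y + \<gamma> * (y * eval_fps (fps_deriv G) y))"
    by (simp add: algebra_simps)
  then have "(\<lambda>n. fps_nth (damped c \<alpha> \<beta> \<gamma> k) n * y ^ n) sums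
      ((\<alpha> + of_nat k * \<beta> + 1) * eval_fps G y + \<gamma> * (y * eval_fps (fps_deriv G) y))"
    unfolding G_def fps_nth_damped_Suc[OF nz] .
  from sums_unique2[OF this sums_eval_fps[OF yR]] show ?thesis by (simp add: G_def mult_ac)
qed

text \<open>
  In terms of \<open>t = L x\<close> this is the preceding identity; \<open>exp (- L x)\<close> is the derivative \<open>1 / x\<close> of the logarithm.
\<close>

lemma damped_has_derivative:
  assumes \<gamma>: "\<gamma> \<noteq> 0" and nz: "\<And>n. \<alpha> + of_nat k * \<beta> + 1 + of_nat n * \<gamma> \<noteq> 0"
    and L: "(L has_field_derivative exp (- L x)) (at x)"
    and y: "ereal (norm (exp (\<gamma> * L x))) < fps_conv_radius c"
  shows "((\<lambda>x. exp ((\<alpha> + of_nat k * \<beta> + 1) * L x) *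
             eval_fps (damped c \<alpha> \<beta> \<gamma> (Suc k)) (exp (\<gamma> * L x)))
     has_field_derivative
       exp ((\<alpha> + of_nat k * \<beta>) * L x) * eval_fps (damped c \<alpha> \<beta> \<gamma> k) (exp (\<gamma> * L x))) (at x)"
proof -
  define d where "d = \<alpha> + of_nat k * \<beta> + 1"
  define G where "G = damped c \<alpha> \<beta> \<gamma> (Suc k)"
  have "ereal (norm (exp (\<gamma> * L x))) < fps_conv_radius G"
    unfolding G_def using fps_conv_radius_damped_ge[OF \<gamma>] y by (rule less_le_trans[rotated])
  then have "(eval_fps G has_field_derivative eval_fps (fps_deriv G) (exp (\<gamma> * L x))) (at (exp (\<gamma> * L x)))"
    by (rule has_field_derivative_eval_fps)
  moreover have "((\<lambda>x. exp (\<gamma> * L x)) has_field_derivative \<gamma> * exp (\<gamma> * L x) * exp (- L x)) (at x)"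
    by (auto intro!: derivative_eq_intros L)
  ultimately have G': "((\<lambda>x. eval_fps G (exp (\<gamma> * L x))) has_field_derivative
      eval_fps (fps_deriv G) (exp (\<gamma> * L x)) * (\<gamma> * exp (\<gamma> * L x) * exp (- L x))) (at x)"
    by (rule DERIV_chain2)
  have "((\<lambda>x. exp (d * L x)) has_field_derivative d * exp (d * L x) * exp (- L x)) (at x)"
    by (auto intro!: derivative_eq_intros L)
  from DERIV_mult[OF this G']
  have "((\<lambda>x. exp (d * L x) * eval_fps G (exp (\<gamma> * L x))) has_field_derivative
     (exp (d * L x) * exp (- L x)) *
     (d * eval_fps G (exp (\<gamma> * L x)) + \<gamma> * exp (\<gamma> * L x) * eval_fps (fps_deriv G) (exp (\<gamma> * L x)))) (at x)"
    by (rule DERIV_cong) (simp add: algebra_simps)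
  also have "d * eval_fps G (exp (\<gamma> * L x)) +
      \<gamma> * exp (\<gamma> * L x) * eval_fps (fps_deriv G) (exp (\<gamma> * L x)) = eval_fps (damped c \<alpha> \<beta> \<gamma> k) (exp (\<gamma> * L x))"
    unfolding d_def G_def by (rule eval_fps_damped_Suc[OF \<gamma> nz y])
  also have "exp (d * L x) * exp (- L x) = exp ((\<alpha> + of_nat k * \<beta>) * L x)"
    by (simp add: d_def algebra_simps flip: exp_add)
  finally show ?thesis by (simp only: d_def G_def)
qed

lemma norm_eval_fps_damped_le:
  assumes \<gamma>: "\<gamma> \<noteq> 0" and y: "ereal (norm y) < fps_conv_radius c" and B: "B > 0"
    and lb: "\<And>n. B \<le> (\<Prod>m<k. norm (\<alpha> + of_nat m * \<beta> + 1 + of_nat n * \<gamma>))"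
  shows "norm (eval_fps (damped c \<alpha> \<beta> \<gamma> k) y) \<le> (\<Sum>n. norm (fps_nth c n * y ^ n)) / B"
proof -
  have yR: "ereal (norm y) < fps_conv_radius (damped c \<alpha> \<beta> \<gamma> k)"
    using fps_conv_radius_damped_ge[OF \<gamma>] y by (rule less_le_trans[rotated])
  have s1: "summable (\<lambda>n. norm (fps_nth (damped c \<alpha> \<beta> \<gamma> k) n * y ^ n))"
    and s2: "summable (\<lambda>n. norm (fps_nth c n * y ^ n))"
    using yR y by (auto intro: norm_summable_fps)
  have "norm (eval_fps (damped c \<alpha> \<beta> \<gamma> k) y) \<le> (\<Sum>n. norm (fps_nth (damped c \<alpha> \<beta> \<gamma> k) n * y ^ n))"
    unfolding eval_fps_def by (rule summable_norm[OF s1])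
  also have "\<dots> \<le> (\<Sum>n. norm (fps_nth c n * y ^ n) / B)"
  proof (rule suminf_le[OF _ s1 summable_divide[OF s2]])
    fix n
    have "norm (fps_nth c n) / (\<Prod>m<k. norm (\<alpha> + of_nat m * \<beta> + 1 + of_nat n * \<gamma>)) \<le> norm (fps_nth c n) / B"
      using B lb[of n] by (intro divide_left_mono mult_pos_pos) auto
    then have "norm (fps_nth c n) / (\<Prod>m<k. norm (\<alpha> + of_nat m * \<beta> + 1 + of_nat n * \<gamma>)) * norm (y ^ n)
        \<le> norm (fps_nth c n) / B * norm (y ^ n)"
      by (rule mult_right_mono) simp
    then show "norm (fps_nth (damped c \<alpha> \<beta> \<gamma> k) n * y ^ n) \<le> norm (fps_nth c n * y ^ n) / B"
      by (simp add: damped_def norm_mult norm_divide flip: prod_norm)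
  qed
  also have "\<dots> = (\<Sum>n. norm (fps_nth c n * y ^ n)) / B" by (rule suminf_divide[OF s2])
  finally show ?thesis .
qed

text \<open>
  The lower bound for the products of divisors is applied with \<open>R \<ge> 2 * norm w\<close>, and with \<open>A = \<alpha> + 1 + n\<gamma>\<close> for all
  \<open>n\<close> at once.
\<close>

lemma damped_geometric_bound:
  assumes \<gamma>: "\<gamma> \<noteq> 0" and \<beta>: "\<beta> \<noteq> 0" and y: "ereal (norm y) < fps_conv_radius c"
    and \<delta>: "\<delta> > 0" "\<And>m n. \<delta> \<le> norm (\<alpha> + of_nat m * \<beta> + 1 + of_nat n * \<gamma>)"
  obtains C where "\<And>N. norm (w ^ N * eval_fps (damped c \<alpha> \<beta> \<gamma> (Suc N)) y) \<le> C * (1 / 2) ^ N"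
proof -
  define R where "R = max \<delta> (2 * norm w)"
  define M where "M = (\<Sum>n. norm (fps_nth c n * y ^ n))"
  have R: "\<delta> \<le> R" "2 * norm w \<le> R" "R > 0" using \<delta> by (auto simp: R_def)
  obtain p where p: "\<And>A k. (\<And>m. \<delta> \<le> norm (A + of_nat m * \<beta>)) \<Longrightarrow>
      (\<delta> / R) ^ p * R ^ k \<le> (\<Prod>m<k. norm (A + of_nat m * \<beta>))"
    using prod_affine_norm_lower_bound[OF \<beta> \<delta>(1) R(1)] by blast
  have lb: "(\<delta> / R) ^ p * R ^ k \<le> (\<Prod>m<k. norm (\<alpha> + of_nat m * \<beta> + 1 + of_nat n * \<gamma>))" for k n
    using p[of "\<alpha> + 1 + of_nat n * \<gamma>" k] \<delta>(2)[of _ n] by (simp add: algebra_simps)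
  have M: "M \<ge> 0" unfolding M_def using y by (intro suminf_nonneg norm_summable_fps) auto
  show thesis
  proof (rule that)
    fix N
    have "norm (eval_fps (damped c \<alpha> \<beta> \<gamma> (Suc N)) y) \<le> M / ((\<delta> / R) ^ p * R ^ Suc N)"
      unfolding M_def using \<delta>(1) R(3) by (intro norm_eval_fps_damped_le[OF \<gamma> y _ lb]) simp
    then have "norm (w ^ N * eval_fps (damped c \<alpha> \<beta> \<gamma> (Suc N)) y) \<le>
        norm w ^ N * (M / ((\<delta> / R) ^ p * R ^ Suc N))"
      unfolding norm_mult norm_power by (intro mult_left_mono) auto
    also have "\<dots> \<le> (R / 2) ^ N * (M / ((\<delta> / R) ^ p * R ^ Suc N))"
      using \<delta> R M by (intro mult_right_mono power_mono divide_nonneg_nonneg) auto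
    also have "\<dots> = M / ((\<delta> / R) ^ p * R) * (1 / 2) ^ N"
      using R by (simp add: power_divide field_simps)
    finally show "norm (w ^ N * eval_fps (damped c \<alpha> \<beta> \<gamma> (Suc N)) y) \<le>
        M / ((\<delta> / R) ^ p * R) * (1 / 2) ^ N" .
  qed
qed

section \<open>The coefficients of the extended hypergeometric series\<close>

lemma foldl_times_map_upt:
  fixes f :: "'a \<Rightarrow> 'b :: comm_monoid_mult"
  shows "foldl (\<lambda>r x. r * f x) v (map g [0..<k]) = v * (\<Prod>m<k. f (g m))"
  by (induction k) (simp_all add: mult_ac)

text \<open>
  Both \<open>s * pochhammer (s + 1) n\<close> and \<open>(s + n) * pochhammer s n\<close> are \<open>pochhammer s (n + 1)\<close>.
\<close>

lemma pochhammer_shift_ratio: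
  fixes s :: complex
  assumes "s + 1 \<notin> \<int>\<^sub>\<le>\<^sub>0" "s \<noteq> 0"
  shows "pochhammer s n / pochhammer (s + 1) n = s / (s + of_nat n)"
proof -
  have "pochhammer (s + 1) n \<noteq> 0" using assms pochhammer_eq_0_imp_nonpos_Int by blast
  moreover have "s + of_nat n \<noteq> 0"
  proof (cases n)
    case (Suc k)
    then have eq: "s + 1 = (s + of_nat n) - of_nat k" by simp
    have "s + 1 = - of_nat k" if "s + of_nat n = 0" unfolding eq that by simp
    then show ?thesis using assms(1) by auto
  qed (use assms in simp)
  moreover have "s * pochhammer (s + 1) n = (s + of_nat n) * pochhammer s n"
    using pochhammer_rec[of s n] pochhammer_rec'[of s n] by simp
  ultimately show ?thesis by (simp add: frac_eq_eq mult_ac)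
qed

lemma divisors_nonzero:
  fixes \<alpha> \<beta> \<gamma> :: complex
  assumes \<gamma>: "\<gamma> \<noteq> 0" and nz: "\<alpha> + of_nat m * \<beta> + 1 \<noteq> 0"
    and lower: "(\<alpha> + \<gamma> + of_nat m * \<beta> + 1) / \<gamma> \<notin> \<int>\<^sub>\<le>\<^sub>0"
  shows "\<alpha> + of_nat m * \<beta> + 1 + of_nat n * \<gamma> \<noteq> 0"
proof (cases n)
  case (Suc k)
  have "(\<alpha> + \<gamma> + of_nat m * \<beta> + 1) / \<gamma> = - of_nat k"
    if "\<alpha> + of_nat m * \<beta> + 1 + of_nat n * \<gamma> = 0"
  proof -
    have "\<alpha> + \<gamma> + of_nat m * \<beta> + 1 = (\<alpha> + of_nat m * \<beta> + 1 + of_nat n * \<gamma>) - of_nat k * \<gamma>"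
      using Suc by (simp add: algebra_simps)
    then have "\<alpha> + \<gamma> + of_nat m * \<beta> + 1 = - of_nat k * \<gamma>" using that by simp
    then show ?thesis using \<gamma> by simp
  qed
  then show ?thesis using lower by auto
qed (use nz in simp)

text \<open>
  The parameter pairs differ by \<open>1\<close>, since \<open>(\<alpha> + \<gamma> + m\<beta> + 1) / \<gamma> = (\<alpha> + m\<beta> + 1) / \<gamma> + 1\<close>; each pair
  contributes one divisor.
\<close>

lemma fps_nth_hypergeo_F:
  assumes \<gamma>: "\<gamma> \<noteq> 0" and nz: "\<And>m. \<alpha> + of_nat m * \<beta> + 1 \<noteq> 0"
    and lower: "\<And>m. (\<alpha> + \<gamma> + of_nat m * \<beta> + 1) / \<gamma> \<notin> \<int>\<^sub>\<le>\<^sub>0"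
  shows "fps_nth (fps_hypergeo (F_upper a \<alpha> \<beta> \<gamma> N) (F_lower b \<alpha> \<beta> \<gamma> N) l) n =
    (\<Prod>m=0..N. \<alpha> + of_nat m * \<beta> + 1) * fps_nth (damped (fps_hypergeo a b l) \<alpha> \<beta> \<gamma> (Suc N)) n"
proof -
  define s where "s = (\<lambda>m. (\<alpha> + of_nat m * \<beta> + 1) / \<gamma>)"
  have s1: "(\<alpha> + \<gamma> + of_nat m * \<beta> + 1) / \<gamma> = s m + 1" for m
    using \<gamma> by (simp add: s_def field_simps)
  have "pochhammer (s m) n / pochhammer (s m + 1) n =
      (\<alpha> + of_nat m * \<beta> + 1) / (\<alpha> + of_nat m * \<beta> + 1 + of_nat n * \<gamma>)" for m
  proof -
    have "s m \<noteq> 0" using nz \<gamma> by (simp add: s_def)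
    then have "pochhammer (s m) n / pochhammer (s m + 1) n = s m / (s m + of_nat n)"
      using lower s1 by (intro pochhammer_shift_ratio) auto
    also have "\<dots> = (\<gamma> * s m) / (\<gamma> * (s m + of_nat n))" using \<gamma> by simp
    also have "\<gamma> * (s m + of_nat n) = \<alpha> + of_nat m * \<beta> + 1 + of_nat n * \<gamma>"
      using \<gamma> by (simp add: s_def field_simps)
    finally show ?thesis using \<gamma> by (simp add: s_def)
  qed
  then have ratio: "(\<Prod>m<Suc N. pochhammer (s m) n) / (\<Prod>m<Suc N. pochhammer (s m + 1) n) =
      (\<Prod>m<Suc N. \<alpha> + of_nat m * \<beta> + 1) / (\<Prod>m<Suc N. \<alpha> + of_nat m * \<beta> + 1 + of_nat n * \<gamma>)"
    by (simp only: flip: prod_dividef)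
  have idx: "{0..N} = {..<Suc N}" by auto
  have "fps_nth (fps_hypergeo (F_upper a \<alpha> \<beta> \<gamma> N) (F_lower b \<alpha> \<beta> \<gamma> N) l) n =
    fps_nth (fps_hypergeo a b l) n *
    ((\<Prod>m<Suc N. pochhammer (s m) n) / (\<Prod>m<Suc N. pochhammer (s m + 1) n))"
    unfolding fps_hypergeo_nth F_upper_def F_lower_def foldl_append foldl_times_map_upt s1
    by (simp add: s_def mult_ac)
  then show ?thesis unfolding ratio idx by (simp add: damped_def)
qed

lemma hypergeom_mult:
  "hypergeom a b (l * y) = eval_fps (fps_hypergeo a b l) y"
  by (simp add: hypergeom_def eval_fps_def power_mult_distrib mult_ac)

lemma hypergeom_converges_mult:
  "hypergeom_converges a b (l * y) \<longleftrightarrow> summable (\<lambda>n. fps_nth (fps_hypergeo a b l) n * y ^ n)"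
  by (simp add: hypergeom_converges_def power_mult_distrib mult_ac)

section \<open>Branches of the logarithm\<close>

text \<open>
  Differentiate \<open>exp (L x) = x\<close>.
\<close>

lemma log_branch_has_derivative:
  assumes "open S" "log_branch_on S L" "x \<in> S"
  shows "(L has_field_derivative exp (- L x)) (at x)"
proof -
  obtain D where D: "(L has_field_derivative D) (at x)"
    using assms holomorphic_on_imp_differentiable_at
    unfolding log_branch_on_def field_differentiable_def by blast
  have "((\<lambda>x. exp (L x)) has_field_derivative exp (L x) * D) (at x)"
    by (rule DERIV_chain2[OF DERIV_exp D])
  moreover have "((\<lambda>x. exp (L x)) has_field_derivative 1) (at x)"
    using assms by (intro has_field_derivative_transform_within_open[OF DERIV_ident \<open>open S\<close>])
      (auto simp: log_branch_on_def)
  ultimately have "exp (L x) * D = 1" by (rule DERIV_unique)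
  then have "D = exp (- L x)" by (simp add: exp_minus field_simps)
  with D show ?thesis by simp
qed

text \<open>
  As a right inverse of \<open>exp\<close>, \<open>L\<close> is injective; being holomorphic, it is an open map. A small shift of \<open>\<gamma> * L x\<close> in the direction
  of the positive real axis is thus again a value of \<open>\<gamma> * L\<close>, and it increases the modulus of the exponential.
\<close>

lemma branch_power_exceeds_modulus:
  assumes S: "open S" "x \<in> S" and L: "log_branch_on S L" and \<gamma>: "\<gamma> \<noteq> 0"
  obtains x' where "x' \<in> S" "norm (branch_power L x \<gamma>) < norm (branch_power L x' \<gamma>)"
proof -
  have "open ((\<lambda>x. \<gamma> * L x) ` S)"
  proof (rule open_mapping_thm3)
    show "(\<lambda>x. \<gamma> * L x) holomorphic_on S"
      using L by (auto simp: log_branch_on_def intro: holomorphic_intros)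
    show "inj_on (\<lambda>x. \<gamma> * L x) S"
      using L \<gamma> by (auto simp: log_branch_on_def inj_on_def) metis
  qed (rule S)
  then obtain e where e: "e > 0" "cball (\<gamma> * L x) e \<subseteq> (\<lambda>x. \<gamma> * L x) ` S"
    using S open_contains_cball by (metis image_eqI)
  have "\<gamma> * L x + of_real e \<in> cball (\<gamma> * L x) e" using e by (simp add: dist_norm)
  with e obtain x' where x': "x' \<in> S" "\<gamma> * L x' = \<gamma> * L x + of_real e" by force
  then have "Re (\<gamma> * L x) < Re (\<gamma> * L x')" using e by simp
  then show thesis using that[OF x'(1)] unfolding branch_power_def norm_exp_eq_Re by simp
qed

text \<open>
  Convergence at a point of larger modulus excludes that \<open>x\<close> lands on the boundary circle.
\<close>

lemma branch_power_inside_convergence_disc: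
  assumes S: "open S" "x \<in> S" and L: "log_branch_on S L" and \<gamma>: "\<gamma> \<noteq> 0"
    and conv: "\<And>x. x \<in> S \<Longrightarrow> summable (\<lambda>n. fps_nth c n * branch_power L x \<gamma> ^ n)"
  shows "ereal (norm (branch_power L x \<gamma>)) < fps_conv_radius c"
proof -
  obtain x' where x': "x' \<in> S" "norm (branch_power L x \<gamma>) < norm (branch_power L x' \<gamma>)"
    using branch_power_exceeds_modulus[OF S L \<gamma>] .
  then have "ereal (norm (branch_power L x' \<gamma>)) \<le> fps_conv_radius c"
    unfolding fps_conv_radius_def using conv by (intro conv_radius_geI) auto
  with x'(2) show ?thesis by (meson ereal_less_le less_ereal.simps(1) order_less_le_trans)
qed

section \<open>The antiderivative\<close>

lemma summable_even_odd_subseries: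
  fixes T :: "nat \<Rightarrow> complex"
  assumes "\<And>N. norm (T N) \<le> C * (1 / 2) ^ N"
  shows "summable (\<lambda>j. T (2 * j))" "summable (\<lambda>j. T (2 * j + 1))"
proof -
  have geo: "summable (\<lambda>N. C * (1 / 2 :: real) ^ N)" by (intro summable_mult summable_geometric) auto
  have "summable (\<lambda>N. norm (T N))"
    using assms by (intro summable_comparison_test'[OF geo, of 0]) auto
  then have "summable ((\<lambda>N. norm (T N)) \<circ> (\<lambda>j. 2 * j))" "summable ((\<lambda>N. norm (T N)) \<circ> (\<lambda>j. 2 * j + 1))"
    by (auto intro!: summable_reindex inj_onI)
  then show "summable (\<lambda>j. T (2 * j))" "summable (\<lambda>j. T (2 * j + 1))"
    by (auto simp: o_def intro: summable_norm_cancel)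
qed

theorem proposition3:
  fixes a b :: "complex list"
    and \<alpha> \<beta> \<gamma> \<eta> l :: complex
    and S :: "complex set"
    and L \<Phi> :: "complex \<Rightarrow> complex"
  assumes gamma: "\<gamma> \<noteq> 0"
    and denominators: "\<And>m::nat. \<alpha> + of_nat m * \<beta> + 1 \<noteq> 0"
    and lower_parameters: "\<And>m::nat. (\<alpha> + \<gamma> + of_nat m * \<beta> + 1) / \<gamma> \<notin> \<int>\<^sub>\<le>\<^sub>0"
    and domain: "open S" "connected S"
    and branch: "log_branch_on S L"
    and integrand_converges:
      "\<And>x. x \<in> S \<Longrightarrow> hypergeom_converges a b (l * branch_power L x \<gamma>)"
    and small_divisor_case:
      "\<And>x. small_divisors \<alpha> \<beta> \<gamma> \<Longrightarrow> x \<in> S \<Longrightarrow> F_series_converge L a b \<alpha> \<beta> \<gamma> \<eta> l x"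
  shows
    "(\<forall>x\<in>S. (\<forall>N. hypergeom_converges (F_upper a \<alpha> \<beta> \<gamma> N) (F_lower b \<alpha> \<beta> \<gamma> N)
                     (l * branch_power L x \<gamma>)) \<and>
            F_series_converge L a b \<alpha> \<beta> \<gamma> \<eta> l x) \<and>
     ((\<forall>x\<in>S. (\<Phi> has_field_derivative
                 branch_power L x \<alpha> * sinh (\<eta> * branch_power L x \<beta>) *
                 hypergeom a b (l * branch_power L x \<gamma>)) (at x)) \<longleftrightarrow>
      (\<exists>C. \<forall>x\<in>S. \<Phi> x =
         branch_power L x (\<alpha> + 1) * sinh (\<eta> * branch_power L x \<beta>) *
           (\<Sum>j. F_term L a b \<alpha> \<beta> \<gamma> \<eta> l (2 * j) x) -
         branch_power L x (\<alpha> + 1) * cosh (\<eta> * branch_power L x \<beta>) *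
           (\<Sum>j. F_term L a b \<alpha> \<beta> \<gamma> \<eta> l (2 * j + 1) x) + C))"
proof -
  define c where "c = fps_hypergeo a b l"
  define y where "y = (\<lambda>x. branch_power L x \<gamma>)"
  define v where "v = (\<lambda>x. \<eta> * branch_power L x \<beta>)"
  define v' where "v' = (\<lambda>x. \<eta> * \<beta> * exp (\<beta> * L x) * exp (- L x))"
  define T where "T = (\<lambda>N x. F_term L a b \<alpha> \<beta> \<gamma> \<eta> l N x)"
  define U where "U = (\<lambda>N x. branch_power L x (\<alpha> + 1) * T N x)"
  have nz: "\<alpha> + of_nat m * \<beta> + 1 + of_nat n * \<gamma> \<noteq> 0" for m n
    using divisors_nonzero[OF gamma denominators lower_parameters] .
  have L': "(L has_field_derivative exp (- L x)) (at x)" if "x \<in> S" for x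
    using log_branch_has_derivative[OF domain(1) branch that] .
  have radius: "ereal (norm (y x)) < fps_conv_radius c" if "x \<in> S" for x
    unfolding y_def using integrand_converges hypergeom_converges_mult
    by (intro branch_power_inside_convergence_disc[OF domain(1) that branch gamma]) (simp add: c_def)
  have radius_damped: "ereal (norm (y x)) < fps_conv_radius (damped c \<alpha> \<beta> \<gamma> k)" if "x \<in> S" for x k
    using fps_conv_radius_damped_ge[OF gamma] radius[OF that] by (rule less_le_trans[rotated])

  have F_nth: "fps_nth (fps_hypergeo (F_upper a \<alpha> \<beta> \<gamma> N) (F_lower b \<alpha> \<beta> \<gamma> N) l) n * y x ^ n =
      (\<Prod>m=0..N. \<alpha> + of_nat m * \<beta> + 1) * (fps_nth (damped c \<alpha> \<beta> \<gamma> (Suc N)) n * y x ^ n)" for N n x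
    unfolding fps_nth_hypergeo_F[OF gamma denominators lower_parameters] c_def by (simp only: mult.assoc)
  have F_converges: "hypergeom_converges (F_upper a \<alpha> \<beta> \<gamma> N) (F_lower b \<alpha> \<beta> \<gamma> N) (l * branch_power L x \<gamma>)"
    if "x \<in> S" for N x
  proof -
    have "hypergeom_converges (F_upper a \<alpha> \<beta> \<gamma> N) (F_lower b \<alpha> \<beta> \<gamma> N) (l * y x)"
      unfolding hypergeom_converges_mult F_nth
      by (intro summable_mult summable_fps radius_damped that)
    then show ?thesis by (simp only: y_def)
  qed
  have T_eq: "T N x = (\<beta> * v x) ^ N * eval_fps (damped c \<alpha> \<beta> \<gamma> (Suc N)) (y x)" if x: "x \<in> S" for N x
  proof -
    have "hypergeom (F_upper a \<alpha> \<beta> \<gamma> N) (F_lower b \<alpha> \<beta> \<gamma> N) (l * y x) =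
        (\<Prod>m=0..N. \<alpha> + of_nat m * \<beta> + 1) * eval_fps (damped c \<alpha> \<beta> \<gamma> (Suc N)) (y x)"
      unfolding hypergeom_mult eval_fps_def F_nth
      by (rule suminf_mult[OF summable_fps[OF radius_damped[OF x]]])
    moreover have "(\<Prod>m=0..N. \<alpha> + of_nat m * \<beta> + 1) \<noteq> 0"
      using denominators by simp
    ultimately show ?thesis
      by (simp add: T_def F_term_def v_def y_def mult.assoc)
  qed

  have converge: "F_series_converge L a b \<alpha> \<beta> \<gamma> \<eta> l x" if x: "x \<in> S" for x
  proof (cases "small_divisors \<alpha> \<beta> \<gamma>")
    case True
    then show ?thesis using small_divisor_case x by blast
  next
    case False
    then obtain \<delta> where \<delta>: "\<delta> > 0" "\<And>m n. \<delta> \<le> norm (\<alpha> + of_nat m * \<beta> + 1 + of_nat n * \<gamma>)"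
      using divisors_bounded_below[OF gamma nz] by blast
    obtain C where "\<And>N. norm (T N x) \<le> C * (1 / 2) ^ N"
    \<comment> \<open>For \<open>\<beta> = 0\<close> the divisors are constant in \<open>m\<close> and their products need not grow,
      but the factor \<open>\<beta> ^ N\<close> kills all terms except the first.\<close>
    proof (cases "\<beta> = 0")
      case True
      then have "norm (T N x) \<le> norm (T 0 x) * (1 / 2) ^ N" for N
        by (cases N) (auto simp: T_eq[OF x])
      then show thesis by (rule that)
    next
      case False
      show thesis
        using damped_geometric_bound[OF gamma False radius[OF x] \<delta>, of "\<beta> * v x"] that
        unfolding T_eq[OF x] by blast
    qed
    from summable_even_odd_subseries[OF this] show ?thesis
      by (simp add: F_series_converge_def T_def)
  qed

  have U_eq: "U N x = (\<beta> * \<eta>) ^ N *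
      (exp ((\<alpha> + of_nat N * \<beta> + 1) * L x) * eval_fps (damped c \<alpha> \<beta> \<gamma> (Suc N)) (exp (\<gamma> * L x)))"
    if "x \<in> S" for N x
  proof -
    have "exp ((\<alpha> + of_nat N * \<beta> + 1) * L x) = exp ((\<alpha> + 1) * L x) * exp (\<beta> * L x) ^ N"
      by (simp add: algebra_simps flip: exp_add exp_of_nat_mult)
    then show ?thesis
      by (simp add: U_def T_eq[OF that] v_def y_def branch_power_def power_mult_distrib mult_ac)
  qed
  have U_deriv: "(U N has_field_derivative (\<beta> * \<eta>) ^ N *
      (exp ((\<alpha> + of_nat N * \<beta>) * L x) * eval_fps (damped c \<alpha> \<beta> \<gamma> N) (exp (\<gamma> * L x)))) (at x)"
    if x: "x \<in> S" for N x
  proof (rule has_field_derivative_transform_within_open[OF _ domain(1) x])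
    show "((\<lambda>x. (\<beta> * \<eta>) ^ N * (exp ((\<alpha> + of_nat N * \<beta> + 1) * L x) *
          eval_fps (damped c \<alpha> \<beta> \<gamma> (Suc N)) (exp (\<gamma> * L x)))) has_field_derivative
        (\<beta> * \<eta>) ^ N * (exp ((\<alpha> + of_nat N * \<beta>) * L x) *
          eval_fps (damped c \<alpha> \<beta> \<gamma> N) (exp (\<gamma> * L x)))) (at x)"
      using radius[OF x] unfolding y_def branch_power_def
      by (intro DERIV_cmult damped_has_derivative gamma nz L'[OF x])
  qed (simp add: U_eq)
  have U0: "(U 0 has_field_derivative branch_power L x \<alpha> * hypergeom a b (l * branch_power L x \<gamma>)) (at x)"
    if "x \<in> S" for x
    using U_deriv[OF that, of 0] by (simp add: hypergeom_mult branch_power_def c_def)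
  have U_Suc: "(U (Suc n) has_field_derivative v' x * U n x) (at x)" if x: "x \<in> S" for n x
  proof (rule DERIV_cong[OF U_deriv[OF x]])
    have "exp ((\<alpha> + of_nat (Suc n) * \<beta>) * L x) =
        exp (\<beta> * L x) * exp (- L x) * exp ((\<alpha> + of_nat n * \<beta> + 1) * L x)"
      by (simp add: algebra_simps flip: exp_add)
    then show "(\<beta> * \<eta>) ^ Suc n * (exp ((\<alpha> + of_nat (Suc n) * \<beta>) * L x) *
        eval_fps (damped c \<alpha> \<beta> \<gamma> (Suc n)) (exp (\<gamma> * L x))) = v' x * U n x"
      by (simp add: U_eq[OF x] v'_def mult_ac)
  qed
  have v: "(v has_field_derivative v' x) (at x)" if "x \<in> S" for x
    unfolding v_def v'_def branch_power_def
    by (auto intro!: derivative_eq_intros L'[OF that])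
  have v': "continuous_on S v'"
    unfolding v'_def using branch
    by (intro continuous_intros) (auto simp: log_branch_on_def intro: holomorphic_on_imp_continuous_on)

  \<comment> \<open>The conclusion is stated with the factor \<open>x powr (\<alpha> + 1)\<close> outside the sums; \<open>W\<close> is its right-hand side.\<close>
  define W where "W = (\<lambda>x. branch_power L x (\<alpha> + 1) * sinh (v x) * (\<Sum>j. T (2 * j) x) -
    branch_power L x (\<alpha> + 1) * cosh (v x) * (\<Sum>j. T (2 * j + 1) x))"
  have T_summable: "summable (\<lambda>j. T (2 * j) x)" "summable (\<lambda>j. T (2 * j + 1) x)" if "x \<in> S" for x
    using converge[OF that] by (simp_all add: F_series_converge_def T_def)
  have U_summable: "summable (\<lambda>j. U (2 * j) x)" "summable (\<lambda>j. U (2 * j + 1) x)" if "x \<in> S" for x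
    unfolding U_def by (intro summable_mult T_summable that)+
  have W': "(W has_field_derivative
      branch_power L x \<alpha> * sinh (v x) * hypergeom a b (l * branch_power L x \<gamma>)) (at x)"
    if x: "x \<in> S" for x
  proof (rule has_field_derivative_transform_within_open[OF _ domain(1) x])
    show "((\<lambda>x. sinh (v x) * (\<Sum>j. U (2 * j) x) - cosh (v x) * (\<Sum>j. U (2 * j + 1) x))
        has_field_derivative
        branch_power L x \<alpha> * sinh (v x) * hypergeom a b (l * branch_power L x \<gamma>)) (at x)"
      using sinh_parts_series_has_derivative[OF domain(1) x v v' U0 U_Suc U_summable]
      by (rule DERIV_cong) (simp_all add: mult_ac)
    show "sinh (v z) * (\<Sum>j. U (2 * j) z) - cosh (v z) * (\<Sum>j. U (2 * j + 1) z) = W z"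
      if "z \<in> S" for z
      unfolding U_def W_def using T_summable[OF that] by (simp add: suminf_mult mult_ac)
  qed

  have "(\<forall>x\<in>S. (\<Phi> has_field_derivative
      branch_power L x \<alpha> * sinh (v x) * hypergeom a b (l * branch_power L x \<gamma>)) (at x)) \<longleftrightarrow>
    (\<exists>C. \<forall>x\<in>S. \<Phi> x = W x + C)" (is "?antiderivative \<longleftrightarrow> ?formula")
  proof
    assume ?antiderivative
    then have "((\<lambda>x. \<Phi> x - W x) has_field_derivative 0) (at x)" if "x \<in> S" for x
      using DERIV_diff[OF _ W'[OF that]] that by fastforce
    then have "(\<lambda>x. \<Phi> x - W x) constant_on S"
      by (rule has_field_derivative_0_imp_constant_on[OF _ domain(2,1)])
    then obtain C where "\<And>x. x \<in> S \<Longrightarrow> \<Phi> x - W x = C" by (auto simp: constant_on_def)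
    then show ?formula by (intro exI[of _ C]) (simp add: algebra_simps)
  next
    assume ?formula
    then obtain C where C: "\<And>x. x \<in> S \<Longrightarrow> \<Phi> x = W x + C" by blast
    show ?antiderivative
    proof
      fix x assume x: "x \<in> S"
      from DERIV_add[OF W'[OF x] DERIV_const[of C]]
      have "((\<lambda>x. W x + C) has_field_derivative
          branch_power L x \<alpha> * sinh (v x) * hypergeom a b (l * branch_power L x \<gamma>)) (at x)" by simp
      then show "(\<Phi> has_field_derivative
          branch_power L x \<alpha> * sinh (v x) * hypergeom a b (l * branch_power L x \<gamma>)) (at x)"
        by (rule has_field_derivative_transform_within_open[OF _ domain(1) x]) (simp add: C)
    qed
  qed
  then show ?thesis
    using F_converges converge unfolding W_def T_def v_def by blast
qed

end
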